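(* Let $n>2$ and $m$ be positive integers with $n\mid m$. Then $2^{\omega(n)}\mid\varphi(n)$ if and only if $n\notin\mathcal{E}$.
   Context: $\varphi$ is Euler's totient function and $\omega(n)$ is the number of distinct prime divisors of $n$. The exception set $\mathcal{E}$ is the set of all integers $n>2$ of the form $n=2\alpha$, where $\alpha$ is a positive odd integer such that every prime $p\mid\alpha$ satisfies $p\equiv 3\pmod 4$. *)

theory Defs
  imports "HOL-Number_Theory.Number_Theory"
begin

text \<open>
  For \<open>n > 0\<close> the set \<open>prime_factors n\<close> consists of exactly the primes dividing \<open>n\<close>, each
  counted once; the junk value at \<open>0\<close> is \<open>omega 0 = 0\<close>.
\<close>
definition omega :: "nat \<Rightarrow> nat" where
  "omega n = card (prime_factors n)"

definition exception_set :: "nat set" where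
  "exception_set = {n. n > 2 \<and> (\<exists>\<alpha>. \<alpha> > 0 \<and> odd \<alpha> \<and> n = 2 * \<alpha> \<and>
     (\<forall>p. prime p \<and> p dvd \<alpha> \<longrightarrow> [p = 3] (mod 4)))}"

end

theory Submission
  imports Defs
begin

text \<open>
  Everything is a comparison of \<open>omega n\<close> with the exponent of 2 in \<open>totient n\<close>. Each odd prime
  \<open>p\<close> dividing \<open>n\<close> puts into \<open>totient n\<close> exactly the powers of 2 that divide \<open>p - 1\<close>: at least
  one, and more than one precisely when \<open>p\<close> is 1 modulo 4. So the odd primes always pay for
  themselves, and the only prime whose contribution can fall short is 2. If \<open>2 ^ Suc k\<close> is the exact
  power of 2 in an even \<open>n\<close>, it contributes \<open>2 ^ k\<close>, which is too little only for \<open>k = 0\<close>. In that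
  case \<open>n\<close> is twice an odd number, one factor 2 is missing, and it is available exactly if some odd
  prime factor has one to spare, that is, if not all of them are 3 modulo 4.

  The contribution of the odd part is computed in \<open>multiplicity_2_totient_odd\<close> and
  turned into divisibility in \<open>two_power_omega_dvd_totient_odd\<close> and
  \<open>two_power_Suc_omega_dvd_totient_odd_iff\<close>.
\<close>

text \<open>
  In Euler's product, the factor of \<open>p\<close> is a power of the odd number \<open>p\<close> times \<open>p - 1\<close>, and
  2-adically the power of \<open>p\<close> is invisible.
\<close>

lemma multiplicity_2_totient_odd:
  fixes a :: nat
  assumes "odd a"
  shows "multiplicity 2 (totient a) = (\<Sum>p\<in>prime_factors a. multiplicity 2 (p - 1))"
proof -
  have pf: "prime p \<and> p > 1 \<and> odd p" if "p \<in> prime_factors a" for p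
    using that assms
    by (auto simp: in_prime_factors_iff prime_gt_1_nat prime_gt_Suc_0_nat)
  have "a > 0"
    using assms by (auto intro: Nat.gr0I)
  then have "multiplicity 2 (totient a) =
      multiplicity 2 (\<Prod>p\<in>prime_factors a. p ^ (multiplicity p a - 1) * (p - 1))"
    by (simp add: totient_formula1)
  also have "\<dots> = (\<Sum>p\<in>prime_factors a. multiplicity 2 (p ^ (multiplicity p a - 1) * (p - 1)))"
    by (rule prime_elem_multiplicity_prod_distrib) (use pf in force)+
  also have "\<dots> = (\<Sum>p\<in>prime_factors a. multiplicity 2 (p - 1))"
  proof (rule sum.cong)
    fix p assume "p \<in> prime_factors a"
    then have "p > 1" "odd p"
      using pf by auto
    then show "multiplicity 2 (p ^ (multiplicity p a - 1) * (p - 1)) = multiplicity 2 (p - 1)"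
      by (subst prime_elem_multiplicity_mult_distrib) (auto simp: not_dvd_imp_multiplicity_0)
  qed simp
  finally show ?thesis .
qed

lemma multiplicity_2_odd_minus_1:
  fixes p :: nat
  assumes "p > 1" "odd p"
  shows "multiplicity 2 (p - 1) \<ge> 1"
    and "multiplicity 2 (p - 1) \<ge> 2 \<longleftrightarrow> \<not> [p = 3] (mod 4)"
proof -
  have "2 ^ 1 dvd p - 1"
    using assms by simp
  then show "multiplicity 2 (p - 1) \<ge> 1"
    using assms by (intro multiplicity_geI) auto
  have "multiplicity 2 (p - 1) \<ge> 2 \<longleftrightarrow> 2 ^ 2 dvd p - 1"
    using assms by (subst power_dvd_iff_le_multiplicity) auto
  also have "\<dots> \<longleftrightarrow> \<not> [p = 3] (mod 4)"
    using assms unfolding cong_def by simp presburger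
  finally show "multiplicity 2 (p - 1) \<ge> 2 \<longleftrightarrow> \<not> [p = 3] (mod 4)" .
qed

lemma card_less_sum_iff:
  fixes f :: "'a \<Rightarrow> nat"
  assumes "finite A" "\<And>x. x \<in> A \<Longrightarrow> f x \<ge> 1"
  shows "card A < sum f A \<longleftrightarrow> (\<exists>x\<in>A. f x \<ge> 2)"
proof
  assume less: "card A < sum f A"
  show "\<exists>x\<in>A. f x \<ge> 2"
  proof (rule ccontr)
    assume "\<not> (\<exists>x\<in>A. f x \<ge> 2)"
    then have "sum f A \<le> (\<Sum>x\<in>A. 1)"
      by (intro sum_mono) force
    with less show False
      by simp
  qed
next
  assume "\<exists>x\<in>A. f x \<ge> 2"
  then have "(\<Sum>x\<in>A. 1) < sum f A"
    using assms by (intro sum_strict_mono_ex1) force+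
  then show "card A < sum f A"
    by simp
qed

lemma two_power_omega_dvd_totient_odd:
  assumes "odd a"
  shows "2 ^ omega a dvd totient a"
proof -
  have "(\<Sum>p\<in>prime_factors a. 1) \<le> (\<Sum>p\<in>prime_factors a. multiplicity 2 (p - 1))"
    using assms
    by (intro sum_mono multiplicity_2_odd_minus_1)
       (auto simp: in_prime_factors_iff prime_gt_1_nat prime_gt_Suc_0_nat)
  then have "omega a \<le> multiplicity 2 (totient a)"
    using assms by (simp add: omega_def multiplicity_2_totient_odd)
  then show ?thesis
    by (rule multiplicity_dvd')
qed

text \<open>
  This is the spare factor 2 that \<open>n = 2 * a\<close> needs: 2 counts as a prime factor of \<open>n\<close>, but
  \<open>totient n = totient a\<close>.
\<close>

lemma two_power_Suc_omega_dvd_totient_odd_iff: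
  assumes "odd a"
  shows "2 ^ Suc (omega a) dvd totient a \<longleftrightarrow> (\<exists>p. prime p \<and> p dvd a \<and> \<not> [p = 3] (mod 4))"
proof -
  have a: "a > 0"
    using assms by (auto intro: Nat.gr0I)
  have pf: "p > 1 \<and> odd p" if "p \<in> prime_factors a" for p
    using that assms
    by (auto simp: in_prime_factors_iff prime_gt_1_nat prime_gt_Suc_0_nat)
  have "2 ^ Suc (omega a) dvd totient a \<longleftrightarrow> omega a < multiplicity 2 (totient a)"
    using a by (subst power_dvd_iff_le_multiplicity) (auto simp: Suc_le_eq)
  also have "\<dots> \<longleftrightarrow> card (prime_factors a) < (\<Sum>p\<in>prime_factors a. multiplicity 2 (p - 1))"
    using assms by (simp add: omega_def multiplicity_2_totient_odd)
  also have "\<dots> \<longleftrightarrow> (\<exists>p\<in>prime_factors a. multiplicity 2 (p - 1) \<ge> 2)"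
    using pf multiplicity_2_odd_minus_1(1) by (intro card_less_sum_iff) auto
  also have "\<dots> \<longleftrightarrow> (\<exists>p\<in>prime_factors a. \<not> [p = 3] (mod 4))"
    using pf multiplicity_2_odd_minus_1(2) by (intro bex_cong) auto
  also have "\<dots> \<longleftrightarrow> (\<exists>p. prime p \<and> p dvd a \<and> \<not> [p = 3] (mod 4))"
    using a by (auto simp: in_prime_factors_iff)
  finally show ?thesis .
qed

lemma omega_two_power_times_odd:
  assumes "odd a"
  shows "omega (2 ^ Suc k * a) = Suc (omega a)"
proof -
  have "a \<noteq> 0"
    using assms by (auto intro: Nat.gr0I)
  then have "prime_factors (2 ^ Suc k * a) = insert 2 (prime_factors a)"
    by (subst prime_factors_product) (auto simp: prime_factorization_prime_power simp del: power_Suc)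
  then show ?thesis
    using assms by (simp add: omega_def in_prime_factors_iff)
qed

lemma totient_two_power_times_odd:
  assumes "odd a"
  shows "totient (2 ^ Suc k * a) = 2 ^ k * totient a"
  using assms by (simp add: totient_mult_coprime totient_prime_power_Suc del: power_Suc)

theorem theorem3p3:
  fixes n m :: nat
  assumes "n > 2" and "m > 0" and "n dvd m"
  shows "2 ^ omega n dvd totient n \<longleftrightarrow> n \<notin> exception_set"
proof (cases "odd n")
  case True
  then have "n \<notin> exception_set"
    by (auto simp: exception_set_def)
  with True show ?thesis
    by (simp add: two_power_omega_dvd_totient_odd)
next
  case even: False
  obtain j a where n_decomp: "n = 2 ^ j * a" and odd: "odd a"
    by (rule multiplicity_decompose'[of n 2]) (use assms(1) in auto)
  with even obtain k where "j = Suc k"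
    by (cases j) auto
  with n_decomp have n: "n = 2 ^ Suc k * a"
    by simp
  have dvd_iff: "2 ^ omega n dvd totient n \<longleftrightarrow> 2 ^ Suc (omega a) dvd 2 ^ k * totient a"
    by (simp only: n omega_two_power_times_odd[OF odd] totient_two_power_times_odd[OF odd])
  show ?thesis
  proof (cases k)
    case 0
    \<comment> \<open>\<open>a\<close> is the only possible \<open>\<alpha>\<close>, and the bound \<open>n > 2\<close> required of exceptional numbers is given.\<close>
    then have "n \<in> exception_set \<longleftrightarrow> (\<forall>p. prime p \<and> p dvd a \<longrightarrow> [p = 3] (mod 4))"
      using n odd assms(1) by (auto simp: exception_set_def)
    then show ?thesis
      unfolding dvd_iff using 0 two_power_Suc_omega_dvd_totient_odd_iff[OF odd] by auto
  next
    case (Suc i)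
    then have "4 dvd n"
      using n by simp
    then have "n \<notin> exception_set"
      by (auto simp: exception_set_def)
    moreover have "2 ^ Suc (omega a) dvd 2 ^ k * totient a"
      using two_power_omega_dvd_totient_odd[OF odd] Suc by (auto intro: mult_dvd_mono)
    ultimately show ?thesis
      by (simp add: dvd_iff)
  qed
qed

end
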